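(* Let $p\ge 3$ be a prime and let $f=\delta_0-\delta_1:\mathbb{Z}_p\to\mathbb{C}$, so that $E=\mathrm{supp}(f)=\{0,1\}$ and $\Sigma=\mathrm{supp}(\hat f)=\mathbb{Z}_p\setminus\{0\}$. Then $$\lim_{k\to\infty}\ |E|\cdot\|1_\Sigma\|_{U^k}^{2^k/(k+1)}=\frac{2}{p}.$$ In particular, for every prime $p\ge 3$ and all sufficiently large $k$ (depending on $p$), the inequality $1\le |E|\cdot\|1_\Sigma\|_{U^k}^{2^k/(k+1)}$ fails for this signal $f$ on $\mathbb{Z}_p$.
   Context: $\mathbb{Z}_N=\mathbb{Z}/N\mathbb{Z}$; $\delta_a$ is the indicator function of the point $a$; $1_S$ is the indicator function of the set $S$; $\mathrm{supp}$ is the set where a function is nonzero. For $f:\mathbb{Z}_N^d\to\mathbb{C}$ the discrete Fourier transform is $\hat f(m)=N^{-d/2}\sum_{x\in\mathbb{Z}_N^d}f(x)\chi(-m\cdot x)$ with $\chi(t)=e^{2\pi i t/N}$ (here used with $N=p$, $d=1$). For $k\ge 2$, the Gowers norm $\|f\|_{U^k}$ is the unique nonnegative real $2^k$-th root of $$\|f\|_{U^k}^{2^k}=\frac{1}{N^{d(k+1)}}\sum_{x\in\mathbb{Z}_N^d}\ \sum_{h_1,\dots,h_k\in\mathbb{Z}_N^d}\ \prod_{w\in\{0,1\}^k}\mathrm{Conj}^{|w|}f(x+w\cdot h),$$ where $h=(h_1,\dots,h_k)$, $w\cdot h=\sum_{i=1}^k w_ih_i$, $|w|=\sum_i w_i$,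 and $\mathrm{Conj}^\ell$ denotes $\ell$-fold complex conjugation. *)

theory Defs
  imports
    Complex_Main
    "HOL-Library.FuncSet"
    "HOL-Library.Indicator_Function"
    "HOL-Computational_Algebra.Primes"
begin

text \<open>
  The group of integers modulo N is represented by its residues 0, ..., N - 1, with addition
  followed by reduction modulo N. A function on this group is a function on the integers of which
  only the values at these residues matter: every definition below evaluates its argument at
  residues only. So the indicator function of a set S of residues is \<^term>\<open>indicator S\<close>.
\<close>

definition ZN :: "nat \<Rightarrow> int set" where
  "ZN N = {0..<int N}"

definition supp :: "nat \<Rightarrow> (int \<Rightarrow> complex) \<Rightarrow> int set" where
  "supp N f = {x \<in> ZN N. f x \<noteq> 0}"

definition chi :: "nat \<Rightarrow> int \<Rightarrow> complex" where
  "chi N t = exp (2 * of_real pi * \<i> * of_int t / of_nat N)"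

definition dft :: "nat \<Rightarrow> (int \<Rightarrow> complex) \<Rightarrow> int \<Rightarrow> complex" where
  "dft N f m = of_real (real N powr (- 1 / 2)) * (\<Sum>x\<in>ZN N. f x * chi N (- (m * x)))"

text \<open>
  The right-hand side of the defining equation of the Gowers norm. The tuples h and w are
  extensional functions on the index set {1..k}.
\<close>

definition gowers_sum :: "nat \<Rightarrow> nat \<Rightarrow> (int \<Rightarrow> complex) \<Rightarrow> complex" where
  "gowers_sum N k f =
     1 / of_nat N ^ (k + 1) *
     (\<Sum>x\<in>ZN N. \<Sum>h\<in>{1..k} \<rightarrow>\<^sub>E ZN N. \<Prod>w\<in>{1..k} \<rightarrow>\<^sub>E {0, 1::nat}.
        (cnj ^^ (\<Sum>i=1..k. w i)) (f ((x + (\<Sum>i=1..k. int (w i) * h i)) mod int N)))"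

definition gowers_norm :: "nat \<Rightarrow> nat \<Rightarrow> (int \<Rightarrow> complex) \<Rightarrow> real" where
  "gowers_norm N k f = (THE r. 0 \<le> r \<and> complex_of_real (r ^ (2 ^ k)) = gowers_sum N k f)"

end

theory Submission
  imports
    Defs
    "HOL-Number_Theory.Cong"
    "HOL-Analysis.Complex_Transcendental"
    "HOL-Real_Asymp.Real_Asymp"
begin

text \<open>
  Since \<open>\<Sigma>\<close> is the complement of 0, the Gowers norm counts the cubes \<open>(x, h)\<close> none of whose
  vertices is 0. A nonempty set of residues that is closed under translation by a nonzero residue is
  everything, so each nonzero \<open>h i\<close> adds a vertex to the cube until all residues are vertices.
  Hence fewer than \<open>p\<close> of the \<open>h i\<close> are nonzero for a cube avoiding 0. For fixed \<open>p\<close> the number of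
  such cubes is at most polynomial in \<open>k\<close> (and at least 1), so its \<open>(k + 1)\<close>-th root tends to 1.
\<close>

section \<open>Residues and subset sums modulo a prime\<close>

lemma finite_ZN [simp]: "finite (ZN N)"
  and card_ZN [simp]: "card (ZN N) = N"
  by (simp_all add: ZN_def)

lemma mod_in_ZN: "N > 0 \<Longrightarrow> y mod int N \<in> ZN N"
  by (simp add: ZN_def)

text \<open>Since \<open>a\<close> is invertible modulo the prime \<open>p\<close>, every residue
  \<open>y\<close> has the form \<open>c + n * a\<close> for a given \<open>c\<close> in
  \<open>C\<close>, so \<open>n\<close> translations lead from \<open>c\<close> to
  \<open>y\<close>.\<close>

lemma translation_closed_eq_ZN:
  fixes p :: nat and a :: int
  assumes p: "prime p" and a: "\<not> int p dvd a"
    and C: "C \<subseteq> ZN p" "C \<noteq> {}"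
    and closed: "\<And>c. c \<in> C \<Longrightarrow> (c + a) mod int p \<in> C"
  shows "C = ZN p"
proof (intro equalityI C subsetI)
  fix y assume y: "y \<in> ZN p"
  have p0: "p > 0" using p by (simp add: prime_gt_0_nat)
  obtain c where c: "c \<in> C" using C by blast
  have mult: "(c + int n * a) mod int p \<in> C" for n
  proof (induction n)
    case 0
    have "c mod int p = c" using c C by (auto simp: ZN_def)
    then show ?case using c by simp
  next
    case (Suc n)
    from closed[OF Suc] show ?case by (simp add: mod_simps algebra_simps)
  qed
  have "coprime a (int p)"
    using p a prime_imp_coprime[of "int p" a] by (simp add: coprime_commute)
  then obtain b where b: "[a * b = 1] (mod int p)"
    using cong_solve_coprime_int by blast
  \<comment> \<open>This is \<open>(y - c) / a\<close> modulo \<open>p\<close>, reduced to a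
    nonnegative representative so that it can serve as a number of translations.\<close>
  define n where "n = nat ((b * (y - c)) mod int p)"
  have n: "int n = (b * (y - c)) mod int p"
    using p0 by (simp add: n_def)
  have "[c + int n * a = c + (b * (y - c)) * a] (mod int p)"
    unfolding n by (intro cong_add cong_mult) (auto simp: Cong.cong_def)
  also have "c + (b * (y - c)) * a = c + (a * b) * (y - c)"
    by (simp add: algebra_simps)
  also have "[c + (a * b) * (y - c) = c + 1 * (y - c)] (mod int p)"
    by (intro cong_add cong_mult b cong_refl)
  finally have "(c + int n * a) mod int p = y mod int p"
    by (simp add: Cong.cong_def)
  also have "\<dots> = y" using y by (auto simp: ZN_def)
  finally show "y \<in> C" using mult[of n] by simp
qed

text \<open>A Cauchy-Davenport bound for the two-element sets \<open>{0, h i}\<close>. Adjoining an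
  index \<open>a\<close> enlarges the set \<open>C\<close> of sums to a set \<open>D\<close> that
  also contains the translate of \<open>C\<close> by \<open>h a\<close>. Either \<open>D\<close> has
  a new element, or \<open>C\<close> is closed under this translation and hence is all of
  \<open>ZN p\<close>; the minimum with \<open>p\<close> covers the latter case.\<close>

lemma card_subset_sums_ge:
  fixes p :: nat and h :: "'a \<Rightarrow> int"
  assumes p: "prime p" and "finite S" and "\<And>i. i \<in> S \<Longrightarrow> \<not> int p dvd h i"
  shows "min p (1 + card S) \<le> card ((\<lambda>I. (x + sum h I) mod int p) ` Pow S)"
  using assms(2,3)
proof (induction S rule: finite_induct)
  case empty
  then show ?case by simp
next
  case (insert a S)
  let ?g = "\<lambda>I. (x + sum h I) mod int p"
  define C where "C = ?g ` Pow S"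
  define D where "D = ?g ` Pow (insert a S)"
  have p0: "p > 0" using p by (simp add: prime_gt_0_nat)
  have IH: "min p (1 + card S) \<le> card C"
    using insert by (simp add: C_def)
  have CD: "C \<subseteq> D" by (auto simp: C_def D_def)
  have translate: "(c + h a) mod int p \<in> D" if "c \<in> C" for c
  proof -
    obtain I where I: "I \<subseteq> S" "c = ?g I" using \<open>c \<in> C\<close> unfolding C_def by blast
    then have "a \<notin> I" "finite I"
      using insert.hyps by (auto intro: finite_subset)
    then have "(c + h a) mod int p = ?g (insert a I)"
      using I by (simp add: mod_simps algebra_simps)
    then show ?thesis using I by (auto simp: D_def)
  qed
  have fin: "finite D" using insert.hyps by (simp add: D_def)
  have "min p (1 + card (insert a S)) \<le> card D"
  proof (cases "C = D")
    case True
    have "C = ZN p"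
    proof (rule translation_closed_eq_ZN[OF p])
      show "\<not> int p dvd h a" using insert.prems by simp
      show "C \<subseteq> ZN p" using p0 by (auto simp: C_def mod_in_ZN)
      show "C \<noteq> {}" by (auto simp: C_def)
    qed (use translate True in auto)
    then show ?thesis using True by simp
  next
    case False
    then have "card C < card D" using CD fin by (simp add: psubset_card_mono)
    then show ?thesis using IH insert.hyps by simp
  qed
  then show ?case by (simp add: D_def)
qed

text \<open>A tuple with at most \<open>Suc m\<close> entries different from \<open>b\<close> either
  has at most \<open>m\<close> of them or arises from such a tuple by overwriting one entry.
  Position and value of that entry give the factor \<open>card A * card B\<close>; the
  \<open>+ 1\<close> stands for no overwriting. For fixed \<open>B\<close> and \<open>m\<close> the
  bound is polynomial in \<open>card A\<close>.\<close>

lemma card_PiE_small_support_le: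
  assumes A: "finite A" and B: "finite B" and b: "b \<in> B"
  shows "card {h \<in> A \<rightarrow>\<^sub>E B. card {i \<in> A. h i \<noteq> b} \<le> m} \<le> (card A * card B + 1) ^ m"
proof (induction m)
  case 0
  have "{h \<in> A \<rightarrow>\<^sub>E B. card {i \<in> A. h i \<noteq> b} \<le> 0} \<subseteq> {restrict (\<lambda>_. b) A}"
  proof
    fix h assume h: "h \<in> {h \<in> A \<rightarrow>\<^sub>E B. card {i \<in> A. h i \<noteq> b} \<le> 0}"
    then have "\<forall>i\<in>A. h i = b" using A by simp
    then have "h = restrict (\<lambda>_. b) A"
      using h by (intro PiE_ext[of h A "\<lambda>_. B"]) (auto intro: b)
    then show "h \<in> {restrict (\<lambda>_. b) A}" by simp
  qed
  then show ?case using card_mono[of "{restrict (\<lambda>_. b) A}"] by simp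
next
  case (Suc m)
  define H where "H = (\<lambda>m. {h \<in> A \<rightarrow>\<^sub>E B. card {i \<in> A. h i \<noteq> b} \<le> m})"
  have fin: "finite (H m)"
    using finite_PiE[of A "\<lambda>_. B"] A B by (simp add: H_def)
  let ?u = "\<lambda>(h, i, c). h(i := c)"
  have "H (Suc m) \<subseteq> H m \<union> ?u ` (H m \<times> A \<times> B)"
  proof
    fix h assume h: "h \<in> H (Suc m)"
    show "h \<in> H m \<union> ?u ` (H m \<times> A \<times> B)"
    proof (cases "\<exists>i\<in>A. h i \<noteq> b")
      case False
      then have "{i \<in> A. h i \<noteq> b} = {}" by auto
      then have "card {i \<in> A. h i \<noteq> b} = 0" by (simp only: card.empty)
      then have "h \<in> H m" using h by (simp add: H_def)
      then show ?thesis by simp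
    next
      case True
      then obtain i where i: "i \<in> A" "h i \<noteq> b" by blast
      define g where "g = h(i := b)"
      have "{j \<in> A. g j \<noteq> b} = {j \<in> A. h j \<noteq> b} - {i}" by (auto simp: g_def)
      then have "card {j \<in> A. g j \<noteq> b} = card {j \<in> A. h j \<noteq> b} - 1"
        using i by (simp add: card_Diff_singleton)
      moreover have "g \<in> A \<rightarrow>\<^sub>E B"
        using h i b by (auto simp: H_def g_def PiE_def extensional_def)
      ultimately have "g \<in> H m" using h by (auto simp: H_def)
      moreover have "h i \<in> B" using h i by (auto simp: H_def)
      moreover have "h = ?u (g, i, h i)" by (simp add: g_def)
      ultimately show ?thesis using i by blast
    qed
  qed
  then have "card (H (Suc m)) \<le> card (H m \<union> ?u ` (H m \<times> A \<times> B))"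
    using fin A B by (intro card_mono) auto
  also have "\<dots> \<le> card (H m) + card (H m \<times> A \<times> B)"
    using fin A B by (intro order_trans[OF card_Un_le] add_mono card_image_le) auto
  also have "\<dots> = card (H m) * (card A * card B + 1)"
    by (simp add: card_cartesian_product algebra_simps)
  also have "\<dots> \<le> (card A * card B + 1) ^ m * (card A * card B + 1)"
    using Suc by (intro mult_right_mono) (simp_all add: H_def)
  finally show ?case by (simp add: H_def algebra_simps)
qed

section \<open>Gowers norm of an indicator function as a count of cubes\<close>

definition cubes_in :: "nat \<Rightarrow> nat \<Rightarrow> int set \<Rightarrow> (int \<times> (nat \<Rightarrow> int)) set" where
  "cubes_in N k S = {(x, h) \<in> ZN N \<times> ({1..k} \<rightarrow>\<^sub>E ZN N).
     \<forall>w\<in>{1..k} \<rightarrow>\<^sub>E {0, 1::nat}. (x + (\<Sum>i=1..k. int (w i) * h i)) mod int N \<in> S}"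

lemma cnj_funpow_of_real [simp]: "(cnj ^^ n) (of_real r) = of_real r"
  by (induction n) auto

lemma gowers_sum_indicator:
  "gowers_sum N k (indicator S) = of_real (real (card (cubes_in N k S)) / real N ^ (k + 1))"
proof -
  let ?W = "{1..k} \<rightarrow>\<^sub>E {0, 1::nat}"
  let ?X = "ZN N \<times> ({1..k} \<rightarrow>\<^sub>E ZN N)"
  let ?v = "\<lambda>x h w. (x + (\<Sum>i=1..k. int (w i) * h i)) mod int N"
  have fin: "finite ?X" "finite ?W" by (auto intro!: finite_PiE)
  \<comment> \<open>Once the values are visibly real, the iterated conjugations disappear and each
    product is 1 or 0.\<close>
  have ind: "(indicator S y :: complex) = of_real (indicator S y)" for y
    by (auto simp: indicator_def)
  have prod: "(\<Prod>w\<in>?W. (cnj ^^ (\<Sum>i=1..k. w i)) (indicator S (?v x h w) :: complex))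
      = (if \<forall>w\<in>?W. ?v x h w \<in> S then 1 else 0)" for x h
    unfolding ind cnj_funpow_of_real
    using fin(2) by (auto simp: indicator_def intro!: prod.neutral)
  have "(\<Sum>x\<in>ZN N. \<Sum>h\<in>{1..k} \<rightarrow>\<^sub>E ZN N. \<Prod>w\<in>?W.
        (cnj ^^ (\<Sum>i=1..k. w i)) (indicator S (?v x h w) :: complex))
      = (\<Sum>(x, h)\<in>?X. if \<forall>w\<in>?W. ?v x h w \<in> S then 1 else 0)"
    unfolding prod by (rule sum.cartesian_product)
  also have "\<dots> = (\<Sum>z\<in>?X. if z \<in> cubes_in N k S then 1 else 0)"
    by (intro sum.cong refl) (auto simp: cubes_in_def split: if_splits)
  also have "\<dots> = of_nat (card (cubes_in N k S))"
  proof -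
    have "?X \<inter> cubes_in N k S = cubes_in N k S" by (auto simp: cubes_in_def)
    then show ?thesis using fin(1) by (simp add: sum.If_cases)
  qed
  finally show ?thesis by (simp add: gowers_sum_def)
qed

text \<open>Resolves the definite description: on the nonnegative reals, taking the
  \<open>2 ^ k\<close>-th power is injective.\<close>

lemma gowers_norm_eq_root:
  assumes "gowers_sum N k f = of_real s" "s \<ge> 0"
  shows "gowers_norm N k f = root (2 ^ k) s"
  unfolding gowers_norm_def
proof (rule the_equality)
  show "0 \<le> root (2 ^ k) s \<and> complex_of_real (root (2 ^ k) s ^ 2 ^ k) = gowers_sum N k f"
    using assms by simp
next
  fix r assume r: "0 \<le> r \<and> complex_of_real (r ^ 2 ^ k) = gowers_sum N k f"
  then have "r ^ 2 ^ k = s" using assms of_real_eq_iff by metis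
  then show "r = root (2 ^ k) s" using r by (metis real_root_pos2 zero_less_numeral zero_less_power)
qed

text \<open>The exponent cancels the \<open>2 ^ k\<close>-th root and turns the normalisation
  \<open>N ^ (k + 1)\<close> into \<open>N\<close>, so that only the \<open>(k + 1)\<close>-th root
  of the cube count depends on \<open>k\<close>.\<close>

lemma gowers_norm_indicator_powr:
  assumes "N > 0"
  shows "gowers_norm N k (indicator S) powr (2 ^ k / (real k + 1))
    = real (card (cubes_in N k S)) powr (1 / (real k + 1)) / real N"
proof -
  define s where "s = real (card (cubes_in N k S)) / real N ^ (k + 1)"
  have s0: "s \<ge> 0" by (simp add: s_def)
  have "gowers_norm N k (indicator S) = s powr (1 / 2 ^ k)"
    using gowers_norm_eq_root[OF gowers_sum_indicator[of N k S, folded s_def] s0] s0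
    by (simp add: root_powr_inverse)
  then have "gowers_norm N k (indicator S) powr (2 ^ k / (real k + 1)) = s powr (1 / (real k + 1))"
    by (simp add: powr_powr)
  also have "\<dots> = real (card (cubes_in N k S)) powr (1 / (real k + 1))
      / (real N ^ (k + 1)) powr (1 / (real k + 1))"
    by (simp add: s_def powr_divide)
  also have "(real N ^ (k + 1)) powr (1 / (real k + 1)) = (real N powr (real k + 1)) powr (1 / (real k + 1))"
    using assms powr_realpow[of "real N" "k + 1"] by (simp add: add.commute)
  also have "\<dots> = real N" using assms by (simp add: powr_powr)
  finally show ?thesis .
qed

text \<open>Taking \<open>w\<close> to be the characteristic function of \<open>I\<close> shows that
  subset sums of \<open>h\<close> are vertices of the cube, which makes
  \<open>card_subset_sums_ge\<close> applicable to cubes.\<close>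

lemma subset_sum_vertex:
  assumes "finite A" "I \<subseteq> A"
  shows "\<exists>w\<in>A \<rightarrow>\<^sub>E {0, 1::nat}. (\<Sum>i\<in>A. int (w i) * h i) = sum h I"
proof
  let ?w = "\<lambda>i\<in>A. if i \<in> I then 1 else 0::nat"
  have "(\<Sum>i\<in>A. int (?w i) * h i) = (\<Sum>i\<in>A. if i \<in> I then h i else 0)"
    by (intro sum.cong) auto
  also have "\<dots> = sum h I"
    using assms by (simp add: sum.If_cases Int_absorb1)
  finally show "(\<Sum>i\<in>A. int (?w i) * h i) = sum h I" .
qed (auto split: if_splits)

text \<open>The first factor counts the base points \<open>x\<close>, the second the tuples
  \<open>h\<close> with at most \<open>p\<close> nonzero entries. Any exponent independent of
  \<open>k\<close> would serve, so the number of nonzero entries is bounded generously.\<close>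

lemma card_nonzero_cubes_le:
  fixes p :: nat
  assumes p: "prime p"
  shows "card (cubes_in p k (ZN p - {0})) \<le> p * (k * p + 1) ^ p"
proof -
  have p0: "p > 0" using p by (simp add: prime_gt_0_nat)
  let ?H = "{h \<in> {1..k} \<rightarrow>\<^sub>E ZN p. card {i \<in> {1..k}. h i \<noteq> 0} \<le> p}"
  have "cubes_in p k (ZN p - {0}) \<subseteq> ZN p \<times> ?H"
  proof (clarify, intro conjI)
    fix x h assume xh: "(x, h) \<in> cubes_in p k (ZN p - {0})"
    then show "x \<in> ZN p" by (auto simp: cubes_in_def)
    from xh have h: "h \<in> {1..k} \<rightarrow>\<^sub>E ZN p" by (auto simp: cubes_in_def)
    define S where "S = {i \<in> {1..k}. h i \<noteq> 0}"
    have "\<not> int p dvd h i" if "i \<in> S" for i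
    proof
      assume "int p dvd h i"
      moreover have "h i \<in> ZN p" "h i \<noteq> 0" using that h by (auto simp: S_def)
      ultimately show False using zdvd_not_zless[of "h i" "int p"] by (auto simp: ZN_def)
    qed
    moreover have "finite S" by (simp add: S_def)
    ultimately have "min p (1 + card S) \<le> card ((\<lambda>I. (x + sum h I) mod int p) ` Pow S)"
      by (intro card_subset_sums_ge p)
    \<comment> \<open>The subset sums are vertices and so avoid 0. There are thus fewer than
      \<open>p\<close> of them, and the minimum above cannot be \<open>p\<close>.\<close>
    also have "\<dots> \<le> card (ZN p - {0})"
    proof (intro card_mono)
      show "(\<lambda>I. (x + sum h I) mod int p) ` Pow S \<subseteq> ZN p - {0}"
      proof (rule image_subsetI)
        fix I assume "I \<in> Pow S"
        then have "I \<subseteq> {1..k}" by (auto simp: S_def)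
        from subset_sum_vertex[OF _ this, of h] obtain w
          where "w \<in> {1..k} \<rightarrow>\<^sub>E {0, 1::nat}" "(\<Sum>i=1..k. int (w i) * h i) = sum h I" by auto
        then show "(x + sum h I) mod int p \<in> ZN p - {0}"
          using xh by (force simp: cubes_in_def)
      qed
    qed simp
    also have "\<dots> < p" using p0 by (simp add: ZN_def)
    finally have "card S \<le> p" by simp
    then show "h \<in> ?H" using h by (simp add: S_def)
  qed
  then have "card (cubes_in p k (ZN p - {0})) \<le> card (ZN p \<times> ?H)"
    using finite_PiE[of "{1..k}" "\<lambda>_. ZN p"] by (intro card_mono) simp_all
  also have "\<dots> = p * card ?H" by (simp add: card_cartesian_product)
  also have "\<dots> \<le> p * (k * p + 1) ^ p"
    using card_PiE_small_support_le[of "{1..k}" "ZN p" 0 p] p0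
    by (intro mult_left_mono) (auto simp: ZN_def)
  finally show ?thesis .
qed

lemma card_nonzero_cubes_ge:
  assumes "N > 1"
  shows "1 \<le> card (cubes_in N k (ZN N - {0}))"
proof -
  \<comment> \<open>The degenerate cube all of whose vertices are 1.\<close>
  have "(1, restrict (\<lambda>_. 0) {1..k}) \<in> cubes_in N k (ZN N - {0})"
    using assms by (auto simp: cubes_in_def ZN_def)
  moreover have "finite (cubes_in N k (ZN N - {0}))"
    by (rule finite_subset[of _ "ZN N \<times> ({1..k} \<rightarrow>\<^sub>E ZN N)"])
      (auto simp: cubes_in_def intro!: finite_PiE)
  ultimately show ?thesis by (metis One_nat_def Suc_leI card_gt_0_iff empty_iff)
qed

lemma nonzero_cubes_growth:
  assumes p: "prime p"
  shows "(\<lambda>k. real (card (cubes_in p k (ZN p - {0}))) powr (1 / (real k + 1))) \<longlonglongrightarrow> 1"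
proof (rule tendsto_sandwich)
  have p1: "p > 1" using p by (rule prime_gt_1_nat)
  let ?M = "\<lambda>k. card (cubes_in p k (ZN p - {0}))"
  \<comment> \<open>The \<open>(k + 1)\<close>-th root of \<open>(p * (k + 1)) ^ (p + 1)\<close>,
    with the power \<open>p + 1\<close> taken outside so that two elementary limits suffice.\<close>
  let ?u = "\<lambda>k. (real p powr (1 / (real k + 1)) * (real k + 1) powr (1 / (real k + 1))) ^ (p + 1)"
  show "\<forall>\<^sub>F k in sequentially. 1 \<le> real (?M k) powr (1 / (real k + 1))"
    using card_nonzero_cubes_ge[OF p1] by (intro always_eventually allI ge_one_powr_ge_zero) auto
  show "\<forall>\<^sub>F k in sequentially. real (?M k) powr (1 / (real k + 1)) \<le> ?u k"
  proof (intro always_eventually allI)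
    fix k
    define c where "c = real p * (real k + 1)"
    have c: "c > 0" using p1 by (simp add: c_def)
    have "?M k \<le> p * (k * p + 1) ^ p" by (rule card_nonzero_cubes_le[OF p])
    \<comment> \<open>Both \<open>p\<close> and \<open>k * p + 1\<close> are at most
      \<open>p * (k + 1)\<close>; a common base makes the bound a pure power.\<close>
    also have "\<dots> \<le> (p * (k + 1)) * (p * (k + 1)) ^ p"
      using p1 by (intro mult_mono power_mono) auto
    also have "\<dots> = (p * (k + 1)) ^ (p + 1)" by simp
    finally have "real (?M k) \<le> real ((p * (k + 1)) ^ (p + 1))"
      using of_nat_le_iff by blast
    also have "\<dots> = c ^ (p + 1)" by (simp add: c_def algebra_simps)
    finally have "real (?M k) powr (1 / (real k + 1)) \<le> (c ^ (p + 1)) powr (1 / (real k + 1))"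
      by (intro powr_mono2) auto
    also have "\<dots> = (c powr (1 / (real k + 1))) ^ (p + 1)"
      using c powr_powr[of c "real (p + 1)"] powr_powr[of c "1 / (real k + 1)" "real (p + 1)"]
      by (simp add: mult.commute flip: powr_realpow del: of_nat_add power_Suc)
    also have "c powr (1 / (real k + 1)) = real p powr (1 / (real k + 1)) * (real k + 1) powr (1 / (real k + 1))"
      by (simp add: c_def powr_mult)
    finally show "real (?M k) powr (1 / (real k + 1)) \<le> ?u k" .
  qed
  have "(\<lambda>k. b powr (1 / (real k + 1))) \<longlonglongrightarrow> 1" if "b > 0" for b :: real
    using that by real_asymp
  moreover have "(\<lambda>k. (real k + 1) powr (1 / (real k + 1))) \<longlonglongrightarrow> 1"
    by real_asymp
  ultimately have "?u \<longlonglongrightarrow> (1 * 1) ^ (p + 1)"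
    using p1 by (intro tendsto_power tendsto_mult) auto
  then show "?u \<longlonglongrightarrow> 1" by simp
qed simp

section \<open>Supports of the signal and of its Fourier transform\<close>

lemma chi_eq_1_iff:
  assumes "N > 0"
  shows "chi N t = 1 \<longleftrightarrow> int N dvd t"
proof -
  have "chi N t = 1 \<longleftrightarrow> (\<exists>n::int. 2 * pi * real_of_int t / real N = real_of_int (2 * n) * pi)"
    by (simp add: chi_def exp_eq_1)
  also have "\<dots> \<longleftrightarrow> (\<exists>n::int. real_of_int t = real_of_int (int N * n))"
    using assms by (simp add: field_simps)
  also have "\<dots> \<longleftrightarrow> int N dvd t"
    by (simp only: of_int_eq_iff dvd_def)
  finally show ?thesis .
qed

lemma supp_delta_diff:
  assumes "N > 1"
  shows "supp N (\<lambda>x. indicator {0} x - indicator {1} x) = {0, 1}"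
  using assms by (auto simp: supp_def ZN_def indicator_def)

lemma dft_delta_diff:
  assumes "N > 1"
  shows "dft N (\<lambda>x. indicator {0} x - indicator {1} x) m
    = of_real (real N powr (- 1 / 2)) * (1 - chi N (- m))"
proof -
  have "(\<Sum>x\<in>ZN N. (indicator {0} x - indicator {1} x) * chi N (- (m * x)))
      = (\<Sum>x\<in>{0, 1}. (indicator {0} x - indicator {1} x) * chi N (- (m * x)))"
    using assms by (intro sum.mono_neutral_right) (auto simp: ZN_def indicator_def)
  also have "\<dots> = 1 - chi N (- m)"
    by (simp add: chi_def)
  finally show ?thesis by (simp add: dft_def)
qed

text \<open>Up to a positive factor the transform is \<open>1 - chi N (- m)\<close>, which vanishes
  only when \<open>N\<close> divides \<open>m\<close>; among the residues this leaves
  \<open>m = 0\<close>.\<close>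

lemma supp_dft_delta_diff:
  assumes "N > 1"
  shows "supp N (dft N (\<lambda>x. indicator {0} x - indicator {1} x)) = ZN N - {0}"
proof -
  have "dft N (\<lambda>x. indicator {0} x - indicator {1} x) m \<noteq> 0 \<longleftrightarrow> m \<noteq> 0" if "m \<in> ZN N" for m
  proof -
    have "dft N (\<lambda>x. indicator {0} x - indicator {1} x) m = 0 \<longleftrightarrow> chi N (- m) = 1"
      unfolding dft_delta_diff[OF assms] using assms by auto
    also have "\<dots> \<longleftrightarrow> int N dvd m"
      using assms chi_eq_1_iff[of N "- m"] by simp
    also have "\<dots> \<longleftrightarrow> m = 0"
      using that zdvd_not_zless[of m "int N"] by (cases "m = 0") (auto simp: ZN_def)
    finally show ?thesis by simp
  qed
  then show ?thesis by (auto simp: supp_def)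
qed

theorem theorem1p4:
  fixes p :: nat and f :: "int \<Rightarrow> complex" and E \<Sigma> :: "int set"
  assumes "prime p" and "p \<ge> 3"
    and "f = (\<lambda>x. indicator {0} x - indicator {1} x)"
    and "E = supp p f"
    and "\<Sigma> = supp p (dft p f)"
  shows "E = {0, 1} \<and> \<Sigma> = ZN p - {0} \<and>
    (\<lambda>k. real (card E) * gowers_norm p k (indicator \<Sigma>) powr (2 ^ k / (real k + 1)))
      \<longlonglongrightarrow> 2 / real p \<and>
    (\<exists>K. \<forall>k\<ge>K. \<not> 1 \<le> real (card E) * gowers_norm p k (indicator \<Sigma>) powr (2 ^ k / (real k + 1)))"
proof -
  let ?a = "\<lambda>k. real (card E) * gowers_norm p k (indicator \<Sigma>) powr (2 ^ k / (real k + 1))"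
  have p1: "p > 1" using assms(2) by simp
  have E: "E = {0, 1}" using assms(3,4) supp_delta_diff[OF p1] by simp
  have S: "\<Sigma> = ZN p - {0}" using assms(3,5) supp_dft_delta_diff[OF p1] by simp
  have "?a = (\<lambda>k. 2 * (real (card (cubes_in p k \<Sigma>)) powr (1 / (real k + 1)) / real p))"
    using p1 by (simp add: E gowers_norm_indicator_powr)
  moreover have "\<dots> \<longlonglongrightarrow> 2 * (1 / real p)"
    unfolding S using p1 by (intro tendsto_intros nonzero_cubes_growth assms(1)) simp
  ultimately have lim: "?a \<longlonglongrightarrow> 2 / real p" by simp
  \<comment> \<open>Here \<open>p \<ge> 3\<close> enters: the limit is strictly below 1, so the
    sequence eventually is too.\<close>
  moreover have "2 / real p < 1" using assms(2) by simp
  ultimately have "\<forall>\<^sub>F k in sequentially. ?a k < 1" by (rule order_tendstoD(2))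
  then have "\<exists>K. \<forall>k\<ge>K. \<not> 1 \<le> ?a k"
    by (simp add: eventually_sequentially not_le)
  then show ?thesis using E S lim by blast
qed

end
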